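(* Let $I\subseteq\mathbb{R}$ be an interval, let $a,b,c,f_1\in C^\infty(I)$ be real-valued with $c(x)\neq 0$ on $I$, and let $C_1\in\mathbb{R}$. Put $$J(x)=\int^{x}\frac{f_1(\phi)-b^2(\phi)}{2c(\phi)}\,d\phi-C_1 .$$ Suppose that for all $x\in I$ $$a(x)=\frac{f_1(x)-\{b(x)+c(x)J(x)\}^2}{4c(x)} .$$ Then the general solution of the Riccati equation $\frac{dy}{dx}=a(x)+b(x)y+c(x)y^2$ is $$y(x)=\frac{e^{\int^{x}\{b(\phi)+c(\phi)J(\phi)\}\,d\phi}}{C_0-\int^{x}c(\psi)\,e^{\int^{\psi}\{b(\phi)+c(\phi)J(\phi)\}\,d\phi}\,d\psi}+\frac12 J(x),$$ where $C_0$ is an arbitrary constant of integration.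
   Context: $\int^{x}g(\phi)\,d\phi$ denotes a fixed antiderivative of $g$ on $I$, the same one wherever the same integrand occurs. "The general solution is $y(x)=\frac{G(x)}{C-H(x)}+y_p(x)$ with $C$ an arbitrary constant" means: for every real $C$, this function satisfies the equation on every subinterval of $I$ on which $C-H$ does not vanish; and conversely every differentiable solution on a nondegenerate subinterval of $I$ is either of this form for some real $C$ (with nonvanishing denominator there) or equal to $y_p$ (the limiting case $C=\infty$). *)

theory Defs
  imports "HOL-Analysis.Analysis"
begin

text \<open>
  All derivatives on an interval are taken relative to that interval, hence are one-sided at
  endpoints belonging to it.
\<close>

text \<open>The witness \<open>D n\<close> is the \<open>n\<close>-th derivative of \<open>f\<close> on \<open>I\<close>.\<close>

definition smooth_on_interval :: "real set \<Rightarrow> (real \<Rightarrow> real) \<Rightarrow> bool" where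
  "smooth_on_interval I f \<longleftrightarrow>
     (\<exists>D :: nat \<Rightarrow> real \<Rightarrow> real. D 0 = f \<and>
        (\<forall>n. \<forall>x\<in>I. (D n has_real_derivative D (Suc n) x) (at x within I)))"

definition antiderivative_on :: "real set \<Rightarrow> (real \<Rightarrow> real) \<Rightarrow> (real \<Rightarrow> real) \<Rightarrow> bool" where
  "antiderivative_on I g F \<longleftrightarrow> (\<forall>x\<in>I. (F has_real_derivative g x) (at x within I))"

definition riccati_solution_on ::
  "(real \<Rightarrow> real) \<Rightarrow> (real \<Rightarrow> real) \<Rightarrow> (real \<Rightarrow> real) \<Rightarrow> real set \<Rightarrow> (real \<Rightarrow> real) \<Rightarrow> bool" where
  "riccati_solution_on a b c S y \<longleftrightarrow>
     (\<forall>x\<in>S. (y has_real_derivative (a x + b x * y x + c x * (y x)\<^sup>2)) (at x within S))"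

text \<open>
  \<open>G x / (C - H x) + y\<^sub>p x\<close>, with \<open>C\<close> an arbitrary constant, is the general solution on \<open>I\<close> of the
  equation whose solutions on a set \<open>S\<close> are given by \<open>sol S\<close>. The function \<open>y\<^sub>p\<close> itself is the
  limiting member \<open>C = \<infinity>\<close> of the family.
\<close>

definition general_solution_on ::
  "real set \<Rightarrow> (real set \<Rightarrow> (real \<Rightarrow> real) \<Rightarrow> bool) \<Rightarrow>
   (real \<Rightarrow> real) \<Rightarrow> (real \<Rightarrow> real) \<Rightarrow> (real \<Rightarrow> real) \<Rightarrow> bool" where
  "general_solution_on I sol G H y\<^sub>p \<longleftrightarrow>
     (\<forall>C S. is_interval S \<and> S \<subseteq> I \<and> (\<forall>x\<in>S. C - H x \<noteq> 0) \<longrightarrow>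
        sol S (\<lambda>x. G x / (C - H x) + y\<^sub>p x)) \<and>
     (\<forall>S y. is_interval S \<and> S \<subseteq> I \<and> (\<exists>p\<in>S. \<exists>q\<in>S. p < q) \<and> sol S y \<longrightarrow>
        (\<exists>C. \<forall>x\<in>S. C - H x \<noteq> 0 \<and> y x = G x / (C - H x) + y\<^sub>p x) \<or>
        (\<forall>x\<in>S. y x = y\<^sub>p x))"

end

theory Submission
  imports Defs
begin

text \<open>
  Under the stated form of \<open>a\<close>, the function \<open>J / 2\<close> is a particular solution of the Riccati
  equation, and the known-solution method does the rest. If \<open>y\<^sub>p\<close> is any particular solution, \<open>P\<close> an
  antiderivative of \<open>b + 2 c y\<^sub>p\<close> and \<open>y = y\<^sub>p + v e\<^sup>P\<close>, then \<open>y\<close> is a solution iff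
  \<open>v' = c e\<^sup>P v\<^sup>2\<close> (\<open>riccati_iff_reduced_equation\<close>). With \<open>Q' = c e\<^sup>P\<close> this separates
  formally to \<open>1 / v = C - Q\<close>.

  Separation divides by \<open>v\<close>, so for the converse one would first have to show that a nonzero \<open>v\<close> has
  no zero. That is avoided by fixing a point where \<open>v\<close> does not vanish, choosing \<open>C\<close> such that
  \<open>v (C - Q) = 1\<close> there, and observing that the defect \<open>v (C - Q) - 1\<close> satisfies a linear homogeneous
  equation. Such a function vanishes identically once it has a zero
  (\<open>linear_homogeneous_ode_zero\<close>), and \<open>v (C - Q) = 1\<close> contains both the formula for \<open>v\<close> and the
  nonvanishing of the denominator.
\<close>

lemma antiderivative_on_subset:
  assumes "antiderivative_on I g F" and "S \<subseteq> I" and "x \<in> S"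
  shows "(F has_real_derivative g x) (at x within S)"
  using assms unfolding antiderivative_on_def by (blast intro: DERIV_subset)

lemma smooth_on_interval_imp_continuous_on:
  assumes "smooth_on_interval I f"
  shows "continuous_on I f"
proof -
  obtain D where "D 0 = f" and "\<forall>x\<in>I. (D 0 has_real_derivative D (Suc 0) x) (at x within I)"
    using assms unfolding smooth_on_interval_def by blast
  then show ?thesis
    by (auto intro: DERIV_continuous_on)
qed

text \<open>
  Dividing by the exponential of an antiderivative of \<open>m\<close> turns the solution into a constant. The
  antiderivative is taken on the compact segment between the two points, since \<open>S\<close> need not be
  compact.
\<close>

lemma linear_homogeneous_ode_zero:
  fixes w m :: "real \<Rightarrow> real"
  assumes "is_interval S" and m: "continuous_on S m"
    and w: "\<And>x. x \<in> S \<Longrightarrow> (w has_real_derivative m x * w x) (at x within S)"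
    and "p \<in> S" and "w p = 0" and "x \<in> S"
  shows "w x = 0"
proof -
  let ?T = "{min p x..max p x}"
  have T: "?T \<subseteq> S"
  proof
    fix t assume "t \<in> ?T"
    moreover have "min p x \<in> S" and "max p x \<in> S"
      using assms(4,6) by (simp_all add: min_def max_def)
    ultimately show "t \<in> S"
      using mem_is_interval_1_I[OF assms(1), of "min p x" "max p x" t] by simp
  qed
  obtain M where M: "\<And>t. t \<in> ?T \<Longrightarrow> (M has_vector_derivative m t) (at t within ?T)"
    using antiderivative_continuous[OF continuous_on_subset[OF m T]] by blast
  have "((\<lambda>t. w t * exp (- M t)) has_real_derivative 0) (at t within ?T)" if t: "t \<in> ?T" for t
  proof -
    have "(M has_real_derivative m t) (at t within ?T)"
      using M[OF t] by (simp add: has_real_derivative_iff_has_vector_derivative)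
    moreover have "(w has_real_derivative m t * w t) (at t within ?T)"
      using w T t by (blast intro: DERIV_subset)
    ultimately show ?thesis
      by (auto intro!: derivative_eq_intros simp: algebra_simps)
  qed
  then obtain k where k: "\<And>t. t \<in> ?T \<Longrightarrow> w t * exp (- M t) = k"
    using has_field_derivative_zero_constant[of ?T "\<lambda>t. w t * exp (- M t)"] by auto
  have "w x * exp (- M x) = w p * exp (- M p)"
    using k[of x] k[of p] by simp
  then show ?thesis
    using \<open>w p = 0\<close> by simp
qed

text \<open>
  The terms of \<open>y'\<close> that do not contain \<open>v\<close> cancel because \<open>y\<^sub>p\<close> is a solution, and the terms linear
  in \<open>v\<close> cancel because \<open>P' = b + 2 c y\<^sub>p\<close>.
\<close>

lemma riccati_iff_reduced_equation:
  assumes yp: "riccati_solution_on a b c S y\<^sub>p"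
    and P: "\<And>x. x \<in> S \<Longrightarrow> (P has_real_derivative b x + 2 * c x * y\<^sub>p x) (at x within S)"
  shows "riccati_solution_on a b c S (\<lambda>x. exp (P x) * v x + y\<^sub>p x) \<longleftrightarrow>
    (\<forall>x\<in>S. (v has_real_derivative c x * exp (P x) * (v x)\<^sup>2) (at x within S))"
    (is "?ric \<longleftrightarrow> ?red")
proof
  assume y: ?ric
  show ?red
  proof
    fix x assume x: "x \<in> S"
    define y where "y = (\<lambda>x. exp (P x) * v x + y\<^sub>p x)"
    have v_eq: "v = (\<lambda>x. (y x - y\<^sub>p x) * exp (- P x))"
      by (simp add: y_def fun_eq_iff exp_minus)
    have "(y has_real_derivative a x + b x * y x + c x * (y x)\<^sup>2) (at x within S)"
      using y x unfolding riccati_solution_on_def y_def by blast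
    moreover have "(y\<^sub>p has_real_derivative a x + b x * y\<^sub>p x + c x * (y\<^sub>p x)\<^sup>2) (at x within S)"
      using yp x unfolding riccati_solution_on_def by blast
    ultimately have "(v has_real_derivative c x * exp (- P x) * (y x - y\<^sub>p x)\<^sup>2) (at x within S)"
      unfolding v_eq using P[OF x]
      by (auto intro!: derivative_eq_intros simp: algebra_simps power2_eq_square)
    moreover have "exp (- P x) * (y x - y\<^sub>p x)\<^sup>2 = exp (P x) * (v x)\<^sup>2"
      by (simp add: y_def exp_minus power2_eq_square)
    ultimately show "(v has_real_derivative c x * exp (P x) * (v x)\<^sup>2) (at x within S)"
      by (simp add: mult.assoc)
  qed
next
  assume v: ?red
  show ?ric
    unfolding riccati_solution_on_def
  proof
    fix x assume x: "x \<in> S"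
    have "((\<lambda>x. exp (P x) * v x + y\<^sub>p x) has_real_derivative
        exp (P x) * (b x + 2 * c x * y\<^sub>p x) * v x + exp (P x) * (c x * exp (P x) * (v x)\<^sup>2)
        + (a x + b x * y\<^sub>p x + c x * (y\<^sub>p x)\<^sup>2)) (at x within S)"
      using v yp P[OF x] x unfolding riccati_solution_on_def
      by (auto intro!: derivative_eq_intros)
    then show "((\<lambda>x. exp (P x) * v x + y\<^sub>p x) has_real_derivative
        a x + b x * (exp (P x) * v x + y\<^sub>p x) + c x * (exp (P x) * v x + y\<^sub>p x)\<^sup>2) (at x within S)"
      by (simp add: algebra_simps power2_eq_square)
  qed
qed

text \<open>
  The known-solution method for the Riccati equation. In the alternative for a given solution, \<open>v = 0\<close>
  identically is the solution \<open>y\<^sub>p\<close>; otherwise the value of \<open>v\<close> at one point determines \<open>C\<close>.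
\<close>

lemma riccati_general_solution_from_particular:
  assumes c: "continuous_on I c"
    and yp: "riccati_solution_on a b c I y\<^sub>p"
    and P: "antiderivative_on I (\<lambda>x. b x + 2 * c x * y\<^sub>p x) P"
    and Q: "antiderivative_on I (\<lambda>x. c x * exp (P x)) Q"
  shows "general_solution_on I (riccati_solution_on a b c) (\<lambda>x. exp (P x)) Q y\<^sub>p"
  unfolding general_solution_on_def
proof (intro conjI allI impI; elim conjE)
  fix C S
  assume S: "S \<subseteq> I" and nz: "\<forall>x\<in>S. C - Q x \<noteq> 0"
  have "riccati_solution_on a b c S y\<^sub>p"
    using yp S unfolding riccati_solution_on_def by (blast intro: DERIV_subset)
  moreover have "((\<lambda>x. 1 / (C - Q x)) has_real_derivative
      c x * exp (P x) * (1 / (C - Q x))\<^sup>2) (at x within S)" if x: "x \<in> S" for x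
    using antiderivative_on_subset[OF Q S x] nz x
    by (auto intro!: derivative_eq_intros simp: power2_eq_square)
  ultimately show "riccati_solution_on a b c S (\<lambda>x. exp (P x) / (C - Q x) + y\<^sub>p x)"
    using riccati_iff_reduced_equation[of a b c S y\<^sub>p P "\<lambda>x. 1 / (C - Q x)"]
      antiderivative_on_subset[OF P S] by simp
next
  fix S y
  assume int: "is_interval S" and S: "S \<subseteq> I" and y: "riccati_solution_on a b c S y"
  define v where "v = (\<lambda>x. (y x - y\<^sub>p x) / exp (P x))"
  have y_eq: "y = (\<lambda>x. exp (P x) * v x + y\<^sub>p x)"
    by (simp add: v_def)
  have "riccati_solution_on a b c S y\<^sub>p"
    using yp S unfolding riccati_solution_on_def by (blast intro: DERIV_subset)
  then have v: "(v has_real_derivative c x * exp (P x) * (v x)\<^sup>2) (at x within S)" if "x \<in> S" for x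
    using y that riccati_iff_reduced_equation[of a b c S y\<^sub>p P v] antiderivative_on_subset[OF P S]
    unfolding y_eq by blast
  show "(\<exists>C. \<forall>x\<in>S. C - Q x \<noteq> 0 \<and> y x = exp (P x) / (C - Q x) + y\<^sub>p x) \<or> (\<forall>x\<in>S. y x = y\<^sub>p x)"
  proof (cases "\<forall>x\<in>S. v x = 0")
    case True
    then show ?thesis
      by (simp add: y_eq)
  next
    case False
    then obtain p where p: "p \<in> S" "v p \<noteq> 0"
      by blast
    define C where "C = 1 / v p + Q p"
    define w where "w = (\<lambda>x. v x * (C - Q x) - 1)"
    have w: "(w has_real_derivative c x * exp (P x) * v x * w x) (at x within S)" if x: "x \<in> S" for x
      using v[OF x] antiderivative_on_subset[OF Q S x] unfolding w_def
      by (auto intro!: derivative_eq_intros simp: algebra_simps power2_eq_square)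
    have cont: "continuous_on S (\<lambda>x. c x * exp (P x) * v x)"
    proof (intro continuous_intros)
      show "continuous_on S c"
        using c S by (rule continuous_on_subset)
      show "continuous_on S P"
        using antiderivative_on_subset[OF P S] by (rule DERIV_continuous_on)
      show "continuous_on S v"
        using v by (rule DERIV_continuous_on)
    qed
    have "w p = 0"
      using p by (simp add: w_def C_def)
    then have "w x = 0" if "x \<in> S" for x
      using linear_homogeneous_ode_zero[OF int cont w p(1) _ that] by simp
    then have vC: "v x * (C - Q x) = 1" if "x \<in> S" for x
      using that by (simp add: w_def)
    have "C - Q x \<noteq> 0 \<and> y x = exp (P x) / (C - Q x) + y\<^sub>p x" if "x \<in> S" for x
    proof -
      have "C - Q x \<noteq> 0"
        using vC[OF that] by auto
      moreover from this have "v x = 1 / (C - Q x)"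
        using vC[OF that] by (simp add: eq_divide_eq)
      ultimately show ?thesis
        by (simp add: y_eq)
    qed
    then show ?thesis
      by blast
  qed
qed

text \<open>
  The equation \<open>a = (f\<^sub>1 - (b + c J)\<^sup>2) / (4 c)\<close> is what remains when one solves
  \<open>(J / 2)' = a + b (J / 2) + c (J / 2)\<^sup>2\<close> for \<open>a\<close> by completing the square, with
  \<open>J' = (f\<^sub>1 - b\<^sup>2) / (2 c)\<close>.
\<close>

lemma riccati_particular_solution_half:
  assumes c: "\<forall>x\<in>I. c x \<noteq> 0"
    and J: "antiderivative_on I (\<lambda>x. (f\<^sub>1 x - (b x)\<^sup>2) / (2 * c x)) J"
    and a: "\<forall>x\<in>I. a x = (f\<^sub>1 x - (b x + c x * J x)\<^sup>2) / (4 * c x)"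
  shows "riccati_solution_on a b c I (\<lambda>x. 1 / 2 * J x)"
  unfolding riccati_solution_on_def
proof
  fix x assume x: "x \<in> I"
  have "((\<lambda>x. 1 / 2 * J x) has_real_derivative 1 / 2 * ((f\<^sub>1 x - (b x)\<^sup>2) / (2 * c x))) (at x within I)"
    using J x unfolding antiderivative_on_def by (blast intro: DERIV_cmult)
  moreover have "1 / 2 * ((f\<^sub>1 x - (b x)\<^sup>2) / (2 * c x))
      = a x + b x * (1 / 2 * J x) + c x * (1 / 2 * J x)\<^sup>2"
  proof -
    have "c x \<noteq> 0" and "a x = (f\<^sub>1 x - (b x + c x * J x)\<^sup>2) / (4 * c x)"
      using c a x by auto
    then show ?thesis
      by (simp add: divide_simps) (simp add: algebra_simps power2_eq_square)
  qed
  ultimately show "((\<lambda>x. 1 / 2 * J x) has_real_derivative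
      a x + b x * (1 / 2 * J x) + c x * (1 / 2 * J x)\<^sup>2) (at x within I)"
    by simp
qed

theorem theorem1:
  fixes I :: "real set"
    and a b c f\<^sub>1 J K P Q :: "real \<Rightarrow> real"
    and C\<^sub>1 :: real
  assumes "is_interval I"
    and "smooth_on_interval I a"
    and "smooth_on_interval I b"
    and "smooth_on_interval I c"
    and "smooth_on_interval I f\<^sub>1"
    and "\<forall>x\<in>I. c x \<noteq> 0"
    and "antiderivative_on I (\<lambda>x. (f\<^sub>1 x - (b x)\<^sup>2) / (2 * c x)) K"
    and "J = (\<lambda>x. K x - C\<^sub>1)"
    and "\<forall>x\<in>I. a x = (f\<^sub>1 x - (b x + c x * J x)\<^sup>2) / (4 * c x)"
    and "antiderivative_on I (\<lambda>x. b x + c x * J x) P"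
    and "antiderivative_on I (\<lambda>x. c x * exp (P x)) Q"
  shows "general_solution_on I (riccati_solution_on a b c)
           (\<lambda>x. exp (P x)) Q (\<lambda>x. 1 / 2 * J x)"
proof (rule riccati_general_solution_from_particular)
  show "continuous_on I c"
    using assms(4) by (rule smooth_on_interval_imp_continuous_on)
  have "antiderivative_on I (\<lambda>x. (f\<^sub>1 x - (b x)\<^sup>2) / (2 * c x)) J"
    using assms(7) unfolding assms(8) antiderivative_on_def
    by (auto intro!: derivative_eq_intros)
  then show "riccati_solution_on a b c I (\<lambda>x. 1 / 2 * J x)"
    using assms(6,9) by (intro riccati_particular_solution_half)
  show "antiderivative_on I (\<lambda>x. b x + 2 * c x * (1 / 2 * J x)) P"
    using assms(10) by simp
  show "antiderivative_on I (\<lambda>x. c x * exp (P x)) Q"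
    by (fact assms(11))
qed

end
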